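(* Let $m,n\in\mathbb{N}$ and $E\subseteq\mathbf T_{m,n}$. Suppose there exist disjoint (possibly empty) sets $\Theta_1,\Theta_2\subseteq\mathbb{S}^{n-1}$ and a closed linear half-space $H$ of $\mathbb{R}^m$ such that: (a) $H\times\Theta_1\subseteq\overline E$; (b) $H\times\{\theta\}\subseteq\overline{E\smallsetminus(H\times\{\theta\})}$ for every $\theta\in\Theta_2$; (c) if $\Theta_1\ne\varnothing$ then $0\in\operatorname{Conv}\big(\overline{(\Theta_1\cup\Theta_2)\smallsetminus\{\theta\}}\big)$ for every $\theta\in\Theta_1$, and if $\Theta_1=\varnothing$ then $0\in\operatorname{Conv}(\overline{\Theta_2})$. Then the collection $\mathcal L_E$ contains a totally dense subcollection.
   Context: $\mathbf T_{m,n}=\mathbb{R}^m\times\mathbb{S}^{n-1}$ with the product topology; closures of subsets of $\mathbf T_{m,n}$ are taken there and closures of subsets of $\mathbb{S}^{n-1}$ in $\mathbb{S}^{n-1}$. $\operatorname{Conv}$ is the convex hull in $\mathbb{R}^n$. A closed linear half-space of $\mathbb{R}^m$ is a set $\{\mathbf x:\mathbf v^\top\mathbf x\ge0\}$ for some nonzero $\mathbf v$. $M_{m,n}$ is the space of real $m\times n$ matrices; for $(\mathbf p,\theta)\in\mathbf T_{m,n}$, $L_{\mathbf p,\theta}=\{A\in M_{m,n}:A\theta=\mathbf p\}$, and $\mathcal L_E=\{L_{\mathbf p,\theta}:(\mathbf p,\theta)\in E\}$. A collection $\mathcal L$ of proper closed subsets of $M_{m,n}$ is dense if its union is dense; totally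 dense if dense and for every open $W$ and $L\in\mathcal L$ with $L\cap W\neq\varnothing$, the closure of $\bigcup\{L'\in\mathcal L:L'\cap L\cap W\ne\varnothing\}$ has nonempty interior. *)

theory Defs
  imports "HOL-Analysis.Analysis"
begin

definition T_space :: "((real ^ 'm) \<times> (real ^ 'n)) set" where
  "T_space = UNIV \<times> sphere 0 1"

definition closed_linear_halfspace :: "(real ^ 'm) set \<Rightarrow> bool" where
  "closed_linear_halfspace H \<longleftrightarrow> (\<exists>v. v \<noteq> 0 \<and> H = {x. v \<bullet> x \<ge> 0})"

definition L_set :: "real ^ 'm \<Rightarrow> real ^ 'n \<Rightarrow> (real ^ 'n ^ 'm) set" where
  "L_set p \<theta> = {A. A *v \<theta> = p}"

definition L_collection :: "((real ^ 'm) \<times> (real ^ 'n)) set \<Rightarrow> (real ^ 'n ^ 'm) set set" where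
  "L_collection E = {L_set p \<theta> | p \<theta>. (p, \<theta>) \<in> E}"

definition dense_collection :: "'a::topological_space set set \<Rightarrow> bool" where
  "dense_collection \<L> \<longleftrightarrow>
     (\<forall>L\<in>\<L>. closed L \<and> L \<noteq> UNIV) \<and> closure (\<Union>\<L>) = UNIV"

definition totally_dense :: "'a::topological_space set set \<Rightarrow> bool" where
  "totally_dense \<L> \<longleftrightarrow> dense_collection \<L> \<and>
     (\<forall>W L. open W \<longrightarrow> L \<in> \<L> \<longrightarrow> L \<inter> W \<noteq> {} \<longrightarrow>
        interior (closure (\<Union>{L' \<in> \<L>. L' \<inter> L \<inter> W \<noteq> {}})) \<noteq> {})"

end

theory Submission imports Defs
begin

text \<open>
  Let \<open>H = {x. v \<bullet> x \<ge> 0}\<close> and \<open>\<Theta> = \<Theta>\<^sub>1 \<union> \<Theta>\<^sub>2\<close>. The subcollection is given by the \<open>(p, \<theta>) \<in> E\<close> with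
  \<open>v \<bullet> p > 0\<close> such that \<open>\<theta>\<close> is not a point of \<open>\<Theta>\<^sub>2\<close> isolated in \<open>\<Theta>\<close>; by (b) its index set \<open>F\<close> still
  accumulates at all of \<open>interior H \<times> \<Theta>\<close>. If \<open>0\<close> is in the convex hull of the closure of a set of
  directions, then for every matrix \<open>A\<close> one of them satisfies \<open>v \<bullet> A\<theta> \<ge> 0\<close>, with strict inequality
  after a rank-one perturbation of \<open>A\<close>; then \<open>(A\<theta>, \<theta>)\<close> is a limit of points of \<open>F\<close>, which gives
  density. For total density at \<open>A\<theta>\<^sub>0 = p\<^sub>0\<close> the perturbation must preserve this equation and
  \<open>\<theta>\<close> must be linearly independent of \<open>\<theta>\<^sub>0\<close>: if \<open>\<theta>\<^sub>0\<close> is a limit of \<open>\<Theta> - {\<theta>\<^sub>0}\<close>, take \<open>\<theta>\<close> close to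
  \<open>\<theta>\<^sub>0\<close>; otherwise apply the hull condition to \<open>\<Theta> - {\<theta>\<^sub>0}\<close>, noting that \<open>v \<bullet> A\<theta>\<^sub>0 > 0\<close> rules out
  \<open>\<theta> = -\<theta>\<^sub>0\<close>.
\<close>

section \<open>Closures, rank-one matrices and the sets \<open>L_set\<close>\<close>

lemma in_closure_iff_open: "x \<in> closure S \<longleftrightarrow> (\<forall>U. open U \<longrightarrow> x \<in> U \<longrightarrow> U \<inter> S \<noteq> {})"
  unfolding closure_iff_nhds_not_empty by blast

lemma closure_of_top_of_set_subset: "top_of_set X closure_of S \<subseteq> closure S"
  by (metis closure_of_subtopology_subset euclidean_closure_of)

definition outer_product :: "real ^ 'm \<Rightarrow> real ^ 'n \<Rightarrow> real ^ 'n ^ 'm" where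
  "outer_product a b = (\<chi> i j. a $ i * b $ j)"

lemma outer_product_mult_vec: "outer_product a b *v x = (b \<bullet> x) *\<^sub>R a"
  by (simp add: vec_eq_iff outer_product_def matrix_vector_mult_def inner_vec_def
      sum_distrib_left sum_distrib_right mult_ac)

lemma tendsto_outer_product [tendsto_intros]:
  assumes "(f \<longlongrightarrow> a) F"
  shows "((\<lambda>x. outer_product (f x) b) \<longlongrightarrow> outer_product a b) F"
  unfolding outer_product_def by (intro tendsto_intros assms)

lemma continuous_on_matrix_vector_mult_left:
  "continuous_on S (\<lambda>A :: real ^ 'n ^ 'm. A *v x)"
  unfolding matrix_vector_mult_def by (intro continuous_intros)

lemma continuous_on_matrix_vector_mult_right:
  "continuous_on S (\<lambda>x. (A :: real ^ 'n ^ 'm) *v x)"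
  unfolding matrix_vector_mult_def by (intro continuous_intros)

lemma tendsto_matrix_vector_mult_right:
  assumes "(f \<longlongrightarrow> x) F"
  shows "((\<lambda>t. (A :: real ^ 'n ^ 'm) *v f t) \<longlongrightarrow> A *v x) F"
  unfolding matrix_vector_mult_def by (intro tendsto_intros assms)

lemma closed_L_set: "closed (L_set p \<theta>)"
  unfolding L_set_def
  by (intro closed_Collect_eq continuous_on_matrix_vector_mult_left continuous_on_const)

lemma L_set_neq_UNIV:
  fixes \<theta> :: "real ^ 'n" and p :: "real ^ 'm"
  assumes "\<theta> \<noteq> 0"
  shows "L_set p \<theta> \<noteq> UNIV"
proof
  assume *: "L_set p \<theta> = UNIV"
  have "A *v \<theta> = p" for A :: "real ^ 'n ^ 'm"
    using * by (auto simp: L_set_def)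
  from this[of 0] this[of "outer_product 1 \<theta>"] show False
    using assms by (auto simp: outer_product_mult_vec)
qed

text \<open>Adding a multiple of \<open>outer_product (p - A *v \<phi>) b\<close> forces the value
  \<open>p\<close> at \<open>\<phi>\<close>. The correction is continuous in
  \<open>(p, \<phi>)\<close> and vanishes at \<open>(A *v \<theta>, \<theta>)\<close>, so it stays
  small nearby. If \<open>b\<close> is orthogonal to some \<open>c\<close>, the value at
  \<open>c\<close> is preserved.\<close>

lemma perturb_to_L_set:
  fixes A :: "real ^ 'n ^ 'm"
  assumes "open W" "A \<in> W" "b \<bullet> \<theta> \<noteq> 0"
  obtains N where "open N" "(A *v \<theta>, \<theta>) \<in> N"
    "\<And>p \<phi>. (p, \<phi>) \<in> N \<Longrightarrow> \<exists>A'\<in>W. A' *v \<phi> = p \<and> (\<forall>y. b \<bullet> y = 0 \<longrightarrow> A' *v y = A *v y)"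
proof -
  define g where "g = (\<lambda>z. A + outer_product ((1 / (b \<bullet> snd z)) *\<^sub>R (fst z - A *v snd z)) b)"
  have lim: "(g \<longlongrightarrow> g (A *v \<theta>, \<theta>)) (nhds (A *v \<theta>, \<theta>))"
    unfolding g_def using assms(3)
    by (auto intro!: tendsto_eq_intros tendsto_matrix_vector_mult_right filterlim_ident)
  have "g (A *v \<theta>, \<theta>) = A"
    by (simp add: g_def outer_product_def vec_eq_iff)
  with lim assms(1,2) have "\<forall>\<^sub>F z in nhds (A *v \<theta>, \<theta>). g z \<in> W"
    by (metis topological_tendstoD)
  moreover have "\<forall>\<^sub>F z in nhds (A *v \<theta>, \<theta>). b \<bullet> snd z \<noteq> 0"
  proof (rule tendsto_imp_eventually_ne)
    show "((\<lambda>z. b \<bullet> snd z) \<longlongrightarrow> b \<bullet> \<theta>) (nhds (A *v \<theta>, \<theta>))"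
      by (auto intro!: tendsto_eq_intros filterlim_ident)
  qed (fact assms(3))
  ultimately have "\<forall>\<^sub>F z in nhds (A *v \<theta>, \<theta>). g z \<in> W \<and> b \<bullet> snd z \<noteq> 0"
    by (rule eventually_conj)
  then obtain N where N: "open N" "(A *v \<theta>, \<theta>) \<in> N"
      "\<And>z. z \<in> N \<Longrightarrow> g z \<in> W \<and> b \<bullet> snd z \<noteq> 0"
    unfolding eventually_nhds by blast
  show thesis
  proof (rule that[OF N(1,2)])
    fix p \<phi> assume "(p, \<phi>) \<in> N"
    with N(3) have "g (p, \<phi>) \<in> W" "b \<bullet> \<phi> \<noteq> 0"
      by force+
    moreover from \<open>b \<bullet> \<phi> \<noteq> 0\<close> have "g (p, \<phi>) *v \<phi> = p"
      by (simp add: g_def matrix_vector_mult_add_rdistrib outer_product_mult_vec)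
    moreover have "g (p, \<phi>) *v y = A *v y" if "b \<bullet> y = 0" for y
      using that by (simp add: g_def matrix_vector_mult_add_rdistrib outer_product_mult_vec)
    ultimately show "\<exists>A'\<in>W. A' *v \<phi> = p \<and> (\<forall>y. b \<bullet> y = 0 \<longrightarrow> A' *v y = A *v y)"
      by blast
  qed
qed

text \<open>Turns accumulation of \<open>F\<close> at \<open>(A *v \<theta>, \<theta>)\<close> into
  accumulation of the sets \<open>L_set p \<phi>\<close> at \<open>A\<close>. Total density uses
  \<open>N\<close> to force these sets to meet a given one.\<close>

lemma L_set_near_limit_point:
  fixes A :: "real ^ 'n ^ 'm"
  assumes "(A *v \<theta>, \<theta>) \<in> closure F" "\<theta> \<noteq> 0"
    and "open W" "A \<in> W" "open N" "(A *v \<theta>, \<theta>) \<in> N"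
  obtains p \<phi> where "(p, \<phi>) \<in> F \<inter> N" "L_set p \<phi> \<inter> W \<noteq> {}"
proof -
  have "\<theta> \<bullet> \<theta> \<noteq> 0"
    using assms(2) by simp
  from perturb_to_L_set[OF assms(3,4) this] obtain N' where N': "open N'" "(A *v \<theta>, \<theta>) \<in> N'"
    "\<And>p \<phi>. (p, \<phi>) \<in> N' \<Longrightarrow> \<exists>A'\<in>W. A' *v \<phi> = p \<and> (\<forall>y. \<theta> \<bullet> y = 0 \<longrightarrow> A' *v y = A *v y)"
    by blast
  have "open (N \<inter> N')" "(A *v \<theta>, \<theta>) \<in> N \<inter> N'"
    using assms N' by auto
  with assms(1) have "(N \<inter> N') \<inter> F \<noteq> {}"
    unfolding in_closure_iff_open by blast
  then obtain p \<phi> where p: "(p, \<phi>) \<in> F" "(p, \<phi>) \<in> N" "(p, \<phi>) \<in> N'"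
    by auto
  from N'(3)[OF p(3)] have "L_set p \<phi> \<inter> W \<noteq> {}"
    by (auto simp: L_set_def)
  with p that show thesis
    by blast
qed

section \<open>Convex hulls, half-spaces and the sign of
  \<open>v \<bullet> (A *v \<theta>)\<close>\<close>

lemma zero_in_convex_hull_imp_nonneg_inner:
  fixes w :: "'a::euclidean_space"
  assumes "0 \<in> convex hull S"
  obtains x where "x \<in> S" "w \<bullet> x \<ge> 0"
proof -
  have False if "\<And>x. x \<in> S \<Longrightarrow> w \<bullet> x < 0"
  proof -
    \<comment> \<open>This open half-space is convex and omits 0.\<close>
    have "convex hull S \<subseteq> {x. w \<bullet> x < 0}"
      using that by (intro hull_minimal) (auto simp: convex_halfspace_lt)
    with assms show False
      by auto
  qed
  with that show thesis
    by (meson not_le)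
qed

lemma closure_inner_pos:
  fixes A :: "real ^ 'n ^ 'm"
  assumes "\<theta> \<in> closure S" "v \<bullet> (A *v \<theta>) > 0"
  obtains \<phi> where "\<phi> \<in> S" "v \<bullet> (A *v \<phi>) > 0"
proof -
  have "open {\<phi>. v \<bullet> (A *v \<phi>) > 0}"
    by (intro open_Collect_less continuous_on_const continuous_on_inner
        continuous_on_matrix_vector_mult_right)
  with assms have "S \<inter> {\<phi>. v \<bullet> (A *v \<phi>) > 0} \<noteq> {}"
    using open_Int_closure_eq_empty by blast
  with that show thesis
    by auto
qed

lemma perturb_inner_pos:
  fixes A :: "real ^ 'n ^ 'm"
  assumes "open W" "A \<in> W" "v \<noteq> 0" "v \<bullet> (A *v \<theta>) \<ge> 0" "b \<bullet> \<theta> > 0"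
  obtains A' where "A' \<in> W" "v \<bullet> (A' *v \<theta>) > 0" "\<And>y. b \<bullet> y = 0 \<Longrightarrow> A' *v y = A *v y"
proof -
  \<comment> \<open>The added term raises \<open>v \<bullet> (A *v \<theta>)\<close> by
    \<open>e * (b \<bullet> \<theta>) * (v \<bullet> v)\<close>, which is positive for
    \<open>e > 0\<close>.\<close>
  define g where "g = (\<lambda>e. A + outer_product (e *\<^sub>R v) b)"
  have lim: "(g \<longlongrightarrow> g 0) (at_right 0)"
    unfolding g_def by (auto intro!: tendsto_eq_intros)
  have "g 0 = A"
    by (simp add: g_def outer_product_def vec_eq_iff)
  with lim assms(1,2) have "\<forall>\<^sub>F e in at_right 0. g e \<in> W"
    by (metis topological_tendstoD)
  then have "\<forall>\<^sub>F e in at_right 0. g e \<in> W \<and> e > 0"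
    using eventually_at_right_less eventually_conj by blast
  then obtain e where e: "g e \<in> W" "e > 0"
    using eventually_happens'[OF trivial_limit_at_right_real] by blast
  have mult: "g e *v y = A *v y + ((b \<bullet> y) * e) *\<^sub>R v" for y
    by (simp add: g_def matrix_vector_mult_add_rdistrib outer_product_mult_vec)
  have "(b \<bullet> \<theta>) * e * (v \<bullet> v) > 0"
    using assms e by simp
  with assms(4) have "v \<bullet> (g e *v \<theta>) > 0"
    by (simp add: mult inner_add_right)
  with e(1) show thesis
    by (rule that) (simp add: mult)
qed

text \<open>For a unit vector \<open>c\<close>, the component of \<open>x\<close> orthogonal to
  \<open>c\<close>. As the vector \<open>b\<close> of a perturbation it fixes the value at
  \<open>c\<close> but moves the value at \<open>x\<close>.\<close>

definition rejection :: "'a::real_inner \<Rightarrow> 'a \<Rightarrow> 'a" where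
  "rejection c x = x - (x \<bullet> c) *\<^sub>R c"

lemma rejection_inner_self [simp]: "norm c = 1 \<Longrightarrow> rejection c x \<bullet> c = 0"
  by (simp add: rejection_def inner_diff_left norm_eq_1)

lemma rejection_inner_pos:
  assumes "norm c = 1" "norm x = 1" "x \<noteq> c" "x \<noteq> - c"
  shows "rejection c x \<bullet> x > 0"
proof -
  have "rejection c x \<bullet> x = rejection c x \<bullet> rejection c x"
    using assms(1) by (simp add: rejection_def inner_diff_left inner_diff_right inner_commute norm_eq_1)
  moreover have "rejection c x \<noteq> 0"
  proof
    assume "rejection c x = 0"
    then have x: "x = (x \<bullet> c) *\<^sub>R c"
      by (simp add: rejection_def)
    then have "norm x = \<bar>x \<bullet> c\<bar> * norm c"
      by (metis norm_scaleR)
    with assms(1,2) have "x \<bullet> c = 1 \<or> x \<bullet> c = - 1"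
      by auto
    with x assms(3,4) show False
      by (metis scaleR_one scaleR_minus1_left)
  qed
  ultimately show ?thesis
    by simp
qed

section \<open>Density and total density from accumulation over a set of directions\<close>

lemma L_collection_dense:
  fixes F :: "((real ^ 'm) \<times> (real ^ 'n)) set"
  assumes F: "F \<subseteq> T_space" and \<Theta>: "\<Theta> \<subseteq> sphere 0 1" and v: "v \<noteq> 0"
    and lim: "\<And>p \<theta>. v \<bullet> p > 0 \<Longrightarrow> \<theta> \<in> \<Theta> \<Longrightarrow> (p, \<theta>) \<in> closure F"
    and hull: "0 \<in> convex hull (closure \<Theta>)"
  shows "dense_collection (L_collection F)"
  unfolding dense_collection_def
proof (intro conjI ballI)
  fix L assume "L \<in> L_collection F"
  then obtain p \<theta> where L: "L = L_set p \<theta>" "(p, \<theta>) \<in> F"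
    by (auto simp: L_collection_def)
  with F have "\<theta> \<noteq> 0"
    by (auto simp: T_space_def)
  with L show "closed L" "L \<noteq> UNIV"
    by (simp_all add: closed_L_set L_set_neq_UNIV)
next
  have "W \<inter> \<Union>(L_collection F) \<noteq> {}" if W: "open W" "A \<in> W" for W and A :: "real ^ 'n ^ 'm"
  proof -
    obtain \<theta> where \<theta>: "\<theta> \<in> closure \<Theta>" "(v v* A) \<bullet> \<theta> \<ge> 0"
      using zero_in_convex_hull_imp_nonneg_inner[OF hull] by blast
    have "norm \<theta> = 1"
      using \<theta>(1) closure_minimal[OF \<Theta>] by auto
    then have "\<theta> \<bullet> \<theta> > 0"
      by auto
    moreover have "v \<bullet> (A *v \<theta>) \<ge> 0"
      using \<theta>(2) by (simp add: dot_lmul_matrix)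
    ultimately obtain A' where A': "A' \<in> W" "v \<bullet> (A' *v \<theta>) > 0"
      using perturb_inner_pos[OF W v] by blast
    \<comment> \<open>The strict inequality is an open condition, so it passes from the closure to
      \<open>\<Theta>\<close> itself.\<close>
    obtain \<phi> where \<phi>: "\<phi> \<in> \<Theta>" "v \<bullet> (A' *v \<phi>) > 0"
      using closure_inner_pos[OF \<theta>(1) A'(2)] by blast
    then have "(A' *v \<phi>, \<phi>) \<in> closure F" "\<phi> \<noteq> 0"
      using lim \<Theta> by auto
    then obtain p \<psi> where "(p, \<psi>) \<in> F \<inter> UNIV" "L_set p \<psi> \<inter> W \<noteq> {}"
      using W(1) A'(1) L_set_near_limit_point[OF _ _ _ _ open_UNIV] by blast
    then show ?thesis
      by (auto simp: L_collection_def)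
  qed
  then show "closure (\<Union>(L_collection F)) = UNIV"
    unfolding in_closure_iff_open set_eq_iff by blast
qed

lemma L_set_transverse_direction:
  fixes A :: "real ^ 'n ^ 'm"
  assumes \<Theta>: "\<Theta> \<subseteq> sphere 0 1" and v: "v \<noteq> 0" and c: "norm c = 1"
    and hull: "c \<in> closure (\<Theta> - {c}) \<or> 0 \<in> convex hull (closure (\<Theta> - {c}))"
    and pos: "v \<bullet> (A *v c) > 0" and W: "open W" "A \<in> W"
  obtains A' \<theta> where "A' \<in> W" "A' *v c = A *v c" "\<theta> \<in> \<Theta>" "\<theta> \<noteq> c" "\<theta> \<noteq> - c" "v \<bullet> (A' *v \<theta>) > 0"
proof -
  obtain A' \<theta> where A': "A' \<in> W" "A' *v c = A *v c" and \<theta>: "\<theta> \<in> closure (\<Theta> - {c})" "v \<bullet> (A' *v \<theta>) > 0"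
  \<comment> \<open>In the first case \<open>A\<close> and \<open>c\<close> themselves serve as
    \<open>A'\<close> and \<open>\<theta>\<close>; a direction other than \<open>c\<close> appears
    only on passing from the closure to \<open>\<Theta> - {c}\<close>.\<close>
  proof (cases "c \<in> closure (\<Theta> - {c})")
    case True
    with W pos that show thesis
      by blast
  next
    case False
    with hull obtain \<theta> where \<theta>: "\<theta> \<in> closure (\<Theta> - {c})" "(v v* A) \<bullet> \<theta> \<ge> 0"
      using zero_in_convex_hull_imp_nonneg_inner by blast
    then have nonneg: "v \<bullet> (A *v \<theta>) \<ge> 0"
      by (simp add: dot_lmul_matrix)
    have "\<theta> \<noteq> c"
      using False \<theta> by blast
    moreover have "\<theta> \<noteq> - c"
      using nonneg pos by (auto simp: linear_neg[OF matrix_vector_mul_linear])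
    moreover have "closure (\<Theta> - {c}) \<subseteq> sphere 0 1"
      using \<Theta> by (intro closure_minimal) auto
    then have "norm \<theta> = 1"
      using \<theta>(1) by auto
    ultimately have "rejection c \<theta> \<bullet> \<theta> > 0"
      using c by (intro rejection_inner_pos)
    then obtain A' where "A' \<in> W" "v \<bullet> (A' *v \<theta>) > 0"
        "\<And>y. rejection c \<theta> \<bullet> y = 0 \<Longrightarrow> A' *v y = A *v y"
      using perturb_inner_pos[OF W v nonneg] by blast
    with c \<theta>(1) that show thesis
      by simp
  qed
  from \<theta> obtain \<phi> where \<phi>: "\<phi> \<in> \<Theta> - {c}" "v \<bullet> (A' *v \<phi>) > 0"
    by (rule closure_inner_pos)
  moreover have "\<phi> \<noteq> - c"
    using \<phi>(2) A'(2) pos by (auto simp: linear_neg[OF matrix_vector_mul_linear])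
  ultimately show thesis
    using A' that by blast
qed

lemma L_collection_totally_dense:
  fixes F :: "((real ^ 'm) \<times> (real ^ 'n)) set"
  assumes F: "F \<subseteq> T_space" and \<Theta>: "\<Theta> \<subseteq> sphere 0 1" and v: "v \<noteq> 0"
    and pos: "\<And>p \<theta>. (p, \<theta>) \<in> F \<Longrightarrow> v \<bullet> p > 0"
    and lim: "\<And>p \<theta>. v \<bullet> p > 0 \<Longrightarrow> \<theta> \<in> \<Theta> \<Longrightarrow> (p, \<theta>) \<in> closure F"
    and hull: "0 \<in> convex hull (closure \<Theta>)"
    and hull': "\<And>p \<theta>. (p, \<theta>) \<in> F \<Longrightarrow>
      \<theta> \<in> closure (\<Theta> - {\<theta>}) \<or> 0 \<in> convex hull (closure (\<Theta> - {\<theta>}))"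
  shows "totally_dense (L_collection F)"
  unfolding totally_dense_def
proof (intro conjI allI impI)
  show "dense_collection (L_collection F)"
    using F \<Theta> v lim hull by (rule L_collection_dense)
next
  fix W and L :: "(real ^ 'n ^ 'm) set"
  assume W: "open W" and "L \<in> L_collection F" and ne: "L \<inter> W \<noteq> {}"
  then obtain p c where L: "L = L_set p c" and pc: "(p, c) \<in> F"
    by (auto simp: L_collection_def)
  from ne L obtain A\<^sub>0 where A\<^sub>0: "A\<^sub>0 *v c = p" "A\<^sub>0 \<in> W"
    by (auto simp: L_set_def)
  have c: "norm c = 1"
    using F pc by (auto simp: T_space_def)
  have "v \<bullet> (A\<^sub>0 *v c) > 0"
    using pos[OF pc] A\<^sub>0 by simp
  from L_set_transverse_direction[OF \<Theta> v c hull'[OF pc] this W A\<^sub>0(2)]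
  obtain A \<theta> where A: "A \<in> W" "A *v c = p"
    and \<theta>: "\<theta> \<in> \<Theta>" "\<theta> \<noteq> c" "\<theta> \<noteq> - c" "v \<bullet> (A *v \<theta>) > 0"
    using A\<^sub>0(1) by metis
  have "norm \<theta> = 1"
    using \<Theta> \<theta>(1) by auto
  then have "rejection c \<theta> \<bullet> \<theta> \<noteq> 0"
    using rejection_inner_pos[OF c _ \<theta>(2,3)] by simp
  from perturb_to_L_set[OF W A(1) this]
  obtain N where N: "open N" "(A *v \<theta>, \<theta>) \<in> N"
    "\<And>p \<phi>. (p, \<phi>) \<in> N \<Longrightarrow>
      \<exists>A'\<in>W. A' *v \<phi> = p \<and> (\<forall>y. rejection c \<theta> \<bullet> y = 0 \<longrightarrow> A' *v y = A *v y)"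
    by blast
  \<comment> \<open>\<open>rejection c \<theta>\<close> is orthogonal to \<open>c\<close>, so the
    matrix \<open>A'\<close> from \<open>N\<close> still takes the value \<open>p\<close> at
    \<open>c\<close> and lies in \<open>L\<close>.\<close>
  have meets: "L_set q \<phi> \<inter> L \<inter> W \<noteq> {}" if "(q, \<phi>) \<in> N" for q \<phi>
    using N(3)[OF that] A(2) c by (fastforce simp: L L_set_def)
  \<comment> \<open>The first condition makes nearby members of the collection meet
    \<open>L \<inter> W\<close>; the second makes \<open>(B *v \<theta>, \<theta>)\<close> a limit
    of points of \<open>F\<close>.\<close>
  define V where "V = (\<lambda>B. (B *v \<theta>, \<theta>)) -` N \<inter> {B. v \<bullet> (B *v \<theta>) > 0}"
  define U where "U = \<Union>{L' \<in> L_collection F. L' \<inter> L \<inter> W \<noteq> {}}"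
  have "open V"
    unfolding V_def
    by (intro open_Int open_vimage N(1) open_Collect_less continuous_on_const continuous_on_inner
        continuous_on_Pair continuous_on_matrix_vector_mult_left)
  have "A \<in> V"
    using N(2) \<theta>(4) by (simp add: V_def)
  have "X \<inter> U \<noteq> {}" if B: "B \<in> V" "open X" "B \<in> X" for B X
  proof -
    have "(B *v \<theta>, \<theta>) \<in> closure F" "(B *v \<theta>, \<theta>) \<in> N"
      using B(1) lim \<theta>(1) by (auto simp: V_def)
    moreover have "\<theta> \<noteq> 0"
      using \<open>norm \<theta> = 1\<close> by auto
    ultimately obtain q \<phi> where "(q, \<phi>) \<in> F \<inter> N" "L_set q \<phi> \<inter> X \<noteq> {}"
      using B(2,3) N(1) L_set_near_limit_point by blast
    with meets show ?thesis
      by (fastforce simp: U_def L_collection_def)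
  qed
  then have "V \<subseteq> closure U"
    unfolding in_closure_iff_open subset_iff by blast
  with \<open>open V\<close> \<open>A \<in> V\<close> have "A \<in> interior (closure U)"
    by (meson interiorI)
  then show "interior (closure (\<Union>{L' \<in> L_collection F. L' \<inter> L \<inter> W \<noteq> {}})) \<noteq> {}"
    unfolding U_def by blast
qed

section \<open>Choice of the subcollection and verification of its limit points\<close>

theorem theorem2p2:
  fixes E :: "((real ^ 'm) \<times> (real ^ 'n)) set"
    and \<Theta>\<^sub>1 \<Theta>\<^sub>2 :: "(real ^ 'n) set"
    and H :: "(real ^ 'm) set"
  assumes "E \<subseteq> T_space"
    and "\<Theta>\<^sub>1 \<subseteq> sphere 0 1"
    and "\<Theta>\<^sub>2 \<subseteq> sphere 0 1"
    and "\<Theta>\<^sub>1 \<inter> \<Theta>\<^sub>2 = {}"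
    and "closed_linear_halfspace H"
    and "H \<times> \<Theta>\<^sub>1 \<subseteq> top_of_set T_space closure_of E"
    and "\<forall>\<theta>\<in>\<Theta>\<^sub>2. H \<times> {\<theta>} \<subseteq> top_of_set T_space closure_of (E - H \<times> {\<theta>})"
    and "\<Theta>\<^sub>1 \<noteq> {} \<longrightarrow>
           (\<forall>\<theta>\<in>\<Theta>\<^sub>1. 0 \<in> convex hull (top_of_set (sphere 0 1) closure_of ((\<Theta>\<^sub>1 \<union> \<Theta>\<^sub>2) - {\<theta>})))"
    and "\<Theta>\<^sub>1 = {} \<longrightarrow> 0 \<in> convex hull (top_of_set (sphere 0 1) closure_of \<Theta>\<^sub>2)"
  shows "\<exists>\<L>. \<L> \<subseteq> L_collection E \<and> totally_dense \<L>"
proof -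
  obtain v where v: "v \<noteq> 0" and H: "H = {x. v \<bullet> x \<ge> 0}"
    using assms(5) by (auto simp: closed_linear_halfspace_def)
  define \<Theta> where "\<Theta> = \<Theta>\<^sub>1 \<union> \<Theta>\<^sub>2"
  \<comment> \<open>For these directions neither alternative of the transversality condition is
    guaranteed, so they are discarded.\<close>
  define I where "I = {\<theta> \<in> \<Theta>\<^sub>2. \<theta> \<notin> closure (\<Theta> - {\<theta>})}"
  \<comment> \<open>Openness of \<open>P\<close> lets limit points of \<open>E\<close> over
    \<open>P\<close> be approached by points of \<open>E\<close> over \<open>P\<close>.\<close>
  define P where "P = {p. v \<bullet> p > 0}"
  define F where "F = E \<inter> P \<times> (- I)"
  have P: "open P"
    unfolding P_def by (rule open_halfspace_gt)
  have PH: "P \<subseteq> H"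
    by (auto simp: P_def H)
  have \<Theta>: "\<Theta> \<subseteq> sphere 0 1"
    using assms(2,3) by (simp add: \<Theta>_def)
  have lim_1: "(p, \<theta>) \<in> closure E" if "p \<in> H" "\<theta> \<in> \<Theta>\<^sub>1" for p \<theta>
  proof (rule subsetD[OF closure_of_top_of_set_subset], rule subsetD[OF assms(6)])
    show "(p, \<theta>) \<in> H \<times> \<Theta>\<^sub>1"
      using that by simp
  qed
  have lim_2: "(p, \<theta>) \<in> closure (E - H \<times> {\<theta>})" if "p \<in> H" "\<theta> \<in> \<Theta>\<^sub>2" for p \<theta>
  proof (rule subsetD[OF closure_of_top_of_set_subset], rule subsetD[OF bspec[OF assms(7) that(2)]])
    show "(p, \<theta>) \<in> H \<times> {\<theta>}"
      using that by simp
  qed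
  have lim_I: "(p, \<theta>) \<in> closure F" if "p \<in> P" "\<theta> \<in> I" for p \<theta>
    unfolding in_closure_iff_open
  proof (intro allI impI)
    fix V assume "open V" "(p, \<theta>) \<in> V"
    \<comment> \<open>The only direction of \<open>\<Theta>\<close> left in this box is
      \<open>\<theta>\<close>, which hypothesis (b) avoids; the point of \<open>E\<close> found here
      thus has direction outside \<open>\<Theta>\<close> and is kept in \<open>F\<close>.\<close>
    define V' where "V' = V \<inter> P \<times> - closure (\<Theta> - {\<theta>})"
    have "open V'"
      unfolding V'_def using \<open>open V\<close> P by (intro open_Int open_Times) auto
    moreover have "(p, \<theta>) \<in> V'"
      using that \<open>(p, \<theta>) \<in> V\<close> by (auto simp: V'_def I_def)
    moreover have "(p, \<theta>) \<in> closure (E - H \<times> {\<theta>})"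
      using that PH by (intro lim_2) (auto simp: I_def)
    ultimately have "V' \<inter> (E - H \<times> {\<theta>}) \<noteq> {}"
      unfolding in_closure_iff_open by blast
    then obtain q \<phi> where q: "(q, \<phi>) \<in> V'" "(q, \<phi>) \<in> E - H \<times> {\<theta>}"
      by auto
    then have "\<phi> \<noteq> \<theta>" "\<phi> \<notin> closure (\<Theta> - {\<theta>})" "q \<in> P"
      using PH by (auto simp: V'_def)
    then have "\<phi> \<notin> \<Theta>"
      using closure_subset[of "\<Theta> - {\<theta>}"] by blast
    then have "(q, \<phi>) \<in> F"
      using q \<open>q \<in> P\<close> by (auto simp: F_def I_def \<Theta>_def)
    with q(1) show "V \<inter> F \<noteq> {}"
      by (auto simp: V'_def)
  qed
  have lim: "(p, \<theta>) \<in> closure F" if "v \<bullet> p > 0" "\<theta> \<in> \<Theta>" for p \<theta>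
  proof -
    have p: "p \<in> P" "p \<in> H"
      using that PH by (auto simp: P_def)
    have "(p, \<theta>) \<in> closure E"
      using that(2) lim_1 lim_2 p(2) closure_mono[of "E - H \<times> {\<theta>}" E] unfolding \<Theta>_def by blast
    moreover have "open (P \<times> (UNIV :: (real ^ 'n) set))"
      using P by (intro open_Times) auto
    ultimately have "(p, \<theta>) \<in> closure (P \<times> UNIV \<inter> E)"
      using p(1) open_Int_closure_subset by blast
    \<comment> \<open>The discarded points of \<open>E\<close> are themselves limits of points of
      \<open>F\<close>.\<close>
    moreover have "P \<times> UNIV \<inter> E \<subseteq> closure F"
    proof clarsimp
      fix q \<phi> assume "q \<in> P" "(q, \<phi>) \<in> E"
      then show "(q, \<phi>) \<in> closure F"
        using lim_I closure_subset[of F] by (cases "\<phi> \<in> I") (auto simp: F_def)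
    qed
    then have "closure (P \<times> UNIV \<inter> E) \<subseteq> closure F"
      by (rule closure_minimal) simp
    ultimately show ?thesis
      by blast
  qed
  have hull_minus: "0 \<in> convex hull (closure (\<Theta> - {\<theta>}))" if "\<theta> \<in> \<Theta>\<^sub>1" for \<theta>
    using assms(8) that subsetD[OF hull_mono[OF closure_of_top_of_set_subset]]
    unfolding \<Theta>_def by (metis empty_iff)
  have hull: "0 \<in> convex hull (closure \<Theta>)"
  proof (cases "\<Theta>\<^sub>1 = {}")
    case True
    then show ?thesis
      using assms(9) subsetD[OF hull_mono[OF closure_of_top_of_set_subset]]
      unfolding \<Theta>_def by (metis sup_bot_left)
  next
    case False
    then obtain \<theta> where "\<theta> \<in> \<Theta>\<^sub>1"
      by blast
    have "convex hull (closure (\<Theta> - {\<theta>})) \<subseteq> convex hull (closure \<Theta>)"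
      by (intro hull_mono closure_mono) auto
    then show ?thesis
      using hull_minus[OF \<open>\<theta> \<in> \<Theta>\<^sub>1\<close>] by blast
  qed
  have "\<theta> \<in> closure (\<Theta> - {\<theta>}) \<or> 0 \<in> convex hull (closure (\<Theta> - {\<theta>}))" if "(p, \<theta>) \<in> F" for p \<theta>
  proof (cases "\<theta> \<in> \<Theta>")
    case True
    \<comment> \<open>A direction outside \<open>I\<close> either lies in
      \<open>\<Theta>\<^sub>1\<close>, where (c) applies, or is a non-isolated point of
      \<open>\<Theta>\<^sub>2\<close>.\<close>
    with that hull_minus show ?thesis
      by (auto simp: F_def I_def \<Theta>_def)
  next
    case False
    with hull show ?thesis
      by simp
  qed
  then have "totally_dense (L_collection F)"
    using assms(1) \<Theta> v lim hull
    by (intro L_collection_totally_dense[of F \<Theta> v]) (auto simp: F_def P_def)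
  moreover have "L_collection F \<subseteq> L_collection E"
    by (auto simp: L_collection_def F_def)
  ultimately show ?thesis
    by blast
qed

end
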